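(* Let $m\ge 0$, $l\ge 1$ and $n\ge 2$ be integers, let $r=\gcd(l,m)$, and let $c_m(\mathcal{P}_n(l))$ be the $m$-cone of the $l$-duplication of the path $\mathcal{P}_n$ with $n$ vertices. Let $f_k(x,y)\in\mathbb{Z}[x,y]$ be the polynomials with $f_{-1}=0$, $f_0=1$ and $f_k(x,y)=x f_{k-1}(x,y)-y^2f_{k-2}(x,y)$ for $k\ge 1$. Then \[ K(c_m(\mathcal{P}_n(l)))\cong\mathbb{Z}_r^{\,n-1}\oplus\mathbb{Z}_{m f_{n-1}(m+2l,-l)/r^{n-1}} . \]
   Context: For a simple graph $\mathcal{G}$ and an integer $l\ge 1$, the $l$-duplication $\mathcal{G}(l)$ is the multigraph obtained by replacing every edge of $\mathcal{G}$ by $l$ parallel edges. For a multigraph $\mathcal{H}$ and an integer $k\ge 0$, the $k$-cone $c_k(\mathcal{H})$ is the multigraph obtained by adding a new vertex $s$ (the sink) and $k$ parallel edges between $s$ and every vertex of $\mathcal{H}$. The Laplacian is $L=D-A$ ($D$ the diagonal degree matrix, $A$ the adjacency matrix counting edge multiplicities), and the reduced Laplacian $L(\cdot,s)$ is obtained by deleting the row and column of $s$. The critical group $K(c_k(\mathcal{H}))$ is the cokernel $\mathbb{Z}^{V(\mathcal{H})}/\mathrm{Im}\,L(c_k(\mathcal{H}),s)^t$, where $L(c_k(\mathcal{H}),s)=L(\mathcal{H})+kI$. $\mathbb{Z}_d=\mathbb{Z}/d\mathbb{Z}$, with $\mathbb{Z}_0=\mathbb{Z}$. *)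

theory Defs
  imports
    "HOL-Library.Multiset"
    "HOL-Computational_Algebra.Polynomial"
    "HOL-Algebra.Product_Groups"
begin

record 'a simple_graph =
  sverts :: "'a set"
  sedges :: "'a set set"

text \<open>Parallel edges are repeated occurrences of the same two-element vertex set. All graphs are
  meant to be finite: infinite edge or vertex sets would contribute no edges below.\<close>

record 'a multigraph =
  mverts :: "'a set"
  medges :: "'a set multiset"

definition path_graph :: "nat \<Rightarrow> nat simple_graph" where
  "path_graph n = \<lparr>sverts = {1..n}, sedges = {{i, i + 1} |i. 1 \<le> i \<and> i < n}\<rparr>"

definition duplication :: "'a simple_graph \<Rightarrow> nat \<Rightarrow> 'a multigraph" where
  "duplication G l = \<lparr>mverts = sverts G, medges = repeat_mset l (mset_set (sedges G))\<rparr>"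

text \<open>The new vertex (the sink) is \<open>None\<close>; an old vertex \<open>v\<close> becomes \<open>Some v\<close>.\<close>

definition cone :: "nat \<Rightarrow> 'a multigraph \<Rightarrow> 'a option multigraph" where
  "cone k H = \<lparr>mverts = insert None (Some ` mverts H),
     medges = image_mset (image Some) (medges H) + (\<Sum>v\<in>mverts H. replicate_mset k {None, Some v})\<rparr>"

definition adjacency :: "'a multigraph \<Rightarrow> 'a \<Rightarrow> 'a \<Rightarrow> int" where
  "adjacency H u v = int (count (medges H) {u, v})"

definition vertex_degree :: "'a multigraph \<Rightarrow> 'a \<Rightarrow> nat" where
  "vertex_degree H v = size {#e \<in># medges H. v \<in> e#}"

definition laplacian :: "'a multigraph \<Rightarrow> 'a \<Rightarrow> 'a \<Rightarrow> int" where
  "laplacian H u v = (if u = v then int (vertex_degree H v) else 0) - adjacency H u v"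

definition vertex_lattice :: "'a set \<Rightarrow> ('a \<Rightarrow> int) monoid" where
  "vertex_lattice W = product_group W (\<lambda>_. integer_group)"

text \<open>The image of the transpose of the reduced Laplacian: rows and columns are indexed by
  the vertices other than \<open>s\<close>, and the sum runs over the row index.\<close>

definition reduced_laplacian_image :: "'a multigraph \<Rightarrow> 'a \<Rightarrow> ('a \<Rightarrow> int) set" where
  "reduced_laplacian_image H s =
     (\<lambda>x. \<lambda>v\<in>mverts H - {s}. \<Sum>u\<in>mverts H - {s}. laplacian H u v * x u)
       ` carrier (vertex_lattice (mverts H - {s}))"

definition critical_group :: "'a multigraph \<Rightarrow> 'a \<Rightarrow> ('a \<Rightarrow> int) set monoid" where
  "critical_group H s = vertex_lattice (mverts H - {s}) Mod reduced_laplacian_image H s"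

text \<open>The ring of integer polynomials in \<open>x\<close> and \<open>y\<close> is represented as polynomials in \<open>y\<close> over
  the integer polynomials in \<open>x\<close>.\<close>

definition var_x :: "int poly poly" where
  "var_x = [:[:0, 1:]:]"

definition var_y :: "int poly poly" where
  "var_y = [:0, 1:]"

definition eval_xy :: "int poly poly \<Rightarrow> int \<Rightarrow> int \<Rightarrow> int" where
  "eval_xy p a b = poly (poly p [:b:]) a"

text \<open>The index starts at \<open>-1\<close>; the values below \<open>-1\<close> are irrelevant and set to \<open>0\<close>.\<close>

function f_poly :: "int \<Rightarrow> int poly poly" where
  "f_poly k = (if k \<le> - 1 then 0 else if k = 0 then 1
     else var_x * f_poly (k - 1) - var_y ^ 2 * f_poly (k - 2))"
  by pat_completeness auto
termination
  by (relation "measure nat") auto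

declare f_poly.simps [simp del]

end

(* Write l = r a and m = r b with a, b coprime, so that the reduced Laplacian is r T, where T is
   tridiagonal with off-diagonal entries -a and diagonal entries b + 2a (b + a at both ends). Let q_k
   be the k-th leading principal minor of T, computed with diagonal entry b + 2a in row n as well. It
   is congruent to b^k modulo a, hence coprime to a. The functionals c_0 = 0,
   c_(k+1)(x) = a c_k(x) + q_k x_(k+1) satisfy c_k(T y) = q_k y_k - a q_(k-1) y_(k+1) for k < n and
   c_n(T y) = d y_n with d = q_n - a q_(n-1) = b f_(n-1)(b + 2a, -a) = det T. Conversely, if d divides
   c_n(x), then T y = x can be solved from the last row upwards: coprimality of a and q_k makes each
   division by a exact. So the image of T is {x. d dvd c_n(x)}.

   With Bezout coefficients s_k q_k + t_k a = 1, the functionals s_k c_k(x) - t_k x_(k+1), for k < n,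
   and c_n form a coordinate system of Z^n. Reducing the former modulo r and the latter modulo r d
   gives a surjection onto Z_r^(n-1) + Z_(r d) whose kernel is r times the image of T. *)

theory Submission
  imports Defs
begin

section \<open>Leading minors, elimination functionals and solvability of the tridiagonal
  system\<close>

fun path_minor :: "int \<Rightarrow> int \<Rightarrow> nat \<Rightarrow> int" where
  "path_minor l m 0 = 1"
| "path_minor l m (Suc 0) = m + l"
| "path_minor l m (Suc (Suc k)) = (m + 2 * l) * path_minor l m (Suc k) - l\<^sup>2 * path_minor l m k"

text \<open>Modulo \<open>l\<close> the recurrence is just multiplication by \<open>m\<close>, so
  the minor is congruent to \<open>m ^ k\<close>.\<close>

lemma coprime_path_minor:
  assumes "coprime l m"
  shows "coprime (path_minor l m k) l"
proof -
  have "l dvd path_minor l m k - m ^ k"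
  proof (induction l m k rule: path_minor.induct)
    case (3 l m k)
    have "path_minor l m (Suc (Suc k)) - m ^ Suc (Suc k)
        = m * (path_minor l m (Suc k) - m ^ Suc k) + l * (2 * path_minor l m (Suc k) - l * path_minor l m k)"
      by (simp add: algebra_simps power2_eq_square)
    then show ?case using 3 by simp
  qed simp_all
  then obtain c where "path_minor l m k = m ^ k + l * c"
    by (metis dvd_def diff_add_cancel add.commute)
  then have "gcd l (path_minor l m k) = gcd l (m ^ k)"
    using gcd_add_mult[of l c "m ^ k"] by (simp add: ac_simps)
  also have "\<dots> = 1"
    using assms by simp
  finally show ?thesis
    by (simp add: coprime_iff_gcd_eq_1 gcd.commute)
qed

text \<open>This is the last row of the adjugate of the leading k by k block: \<open>x i\<close> has
  coefficient \<open>l ^ (k - i) * path_minor l m (i - 1)\<close>. Entries are indexed from 1, so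
  \<open>x 0\<close> is never read.\<close>

primrec path_functional :: "int \<Rightarrow> int \<Rightarrow> nat \<Rightarrow> (nat \<Rightarrow> int) \<Rightarrow> int" where
  "path_functional l m 0 x = 0"
| "path_functional l m (Suc k) x = l * path_functional l m k x + path_minor l m k * x (Suc k)"

lemma path_functional_add:
  "path_functional l m k (\<lambda>i. x i + y i) = path_functional l m k x + path_functional l m k y"
  by (induction k) (simp_all add: algebra_simps)

lemma path_functional_scale: "path_functional l m k (\<lambda>i. c * x i) = c * path_functional l m k x"
  by (induction k) (simp_all add: algebra_simps)

lemma path_functional_cong:
  "(\<And>i. 1 \<le> i \<Longrightarrow> i \<le> k \<Longrightarrow> x i = y i) \<Longrightarrow> path_functional l m k x = path_functional l m k y"
  by (induction k) simp_all

text \<open>The reduced Laplacian of the \<open>m\<close>-cone of \<open>\<P>\<^sub>n(l)\<close>, applied to \<open>y\<close>.\<close>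

definition path_operator :: "int \<Rightarrow> int \<Rightarrow> nat \<Rightarrow> (nat \<Rightarrow> int) \<Rightarrow> nat \<Rightarrow> int" where
  "path_operator l m n y v = m * y v + (if 1 < v then l * (y v - y (v - 1)) else 0)
     + (if v < n then l * (y v - y (v + 1)) else 0)"

lemma path_operator_scale: "path_operator (r * l) (r * m) n y v = r * path_operator l m n y v"
  by (simp add: path_operator_def algebra_simps)

lemma path_operator_cong:
  assumes "\<And>i. i \<in> {1..n} \<Longrightarrow> x i = y i" "v \<in> {1..n}"
  shows "path_operator l m n x v = path_operator l m n y v"
proof -
  have "x (v - 1) = y (v - 1)" if "1 < v"
    using assms that by (intro assms(1)) auto
  moreover have "x (v + 1) = y (v + 1)" if "v < n"
    using assms that by (intro assms(1)) auto
  ultimately show ?thesis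
    using assms by (simp add: path_operator_def)
qed

text \<open>For n at least 2 this is the determinant: \<open>path_minor\<close> treats row
  \<open>n\<close> as interior, and lowering its diagonal entry from \<open>m + 2 * l\<close> to
  \<open>m + l\<close> takes off \<open>l\<close> times the preceding minor.\<close>

definition path_det :: "int \<Rightarrow> int \<Rightarrow> nat \<Rightarrow> int" where
  "path_det l m n = path_minor l m n - l * path_minor l m (n - 1)"

text \<open>Elimination without division: in \<open>l\<close> times the relation for
  \<open>k\<close> plus \<open>path_minor l m k\<close> times row \<open>k + 1\<close>, the unknown
  \<open>y k\<close> cancels and the recurrence of the minors appears.\<close>

lemma path_functional_path_operator_less:
  assumes "1 \<le> k" "k < n"
  shows "path_functional l m k (path_operator l m n y)
       = path_minor l m k * y k - l * path_minor l m (k - 1) * y (k + 1)"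
  using assms
proof (induction k rule: nat_induct_at_least)
  case base
  then show ?case by (simp add: path_operator_def algebra_simps)
next
  case (Suc k)
  then obtain j where "k = Suc j" by (cases k) auto
  with Suc show ?case
    by (simp add: path_operator_def algebra_simps power2_eq_square)
qed

text \<open>Row \<open>n\<close> has no right neighbour, so the elimination ends with the single
  unknown \<open>y n\<close>.\<close>

lemma path_functional_path_operator:
  assumes "n \<ge> 2"
  shows "path_functional l m n (path_operator l m n y) = path_det l m n * y n"
proof -
  obtain j where n: "n = Suc (Suc j)" using assms by (metis add_2_eq_Suc le_Suc_ex)
  have "path_functional l m (Suc j) (path_operator l m n y)
       = path_minor l m (Suc j) * y (Suc j) - l * path_minor l m j * y n"
    using path_functional_path_operator_less[of "Suc j" n] n by simp
  then show ?thesis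
    unfolding n by (simp add: path_operator_def path_det_def algebra_simps power2_eq_square)
qed

lemma dvd_path_functional_imp_path_operator:
  assumes "coprime l m" "l \<noteq> 0" "n \<ge> 2" "path_det l m n dvd path_functional l m n x"
  shows "\<exists>y. \<forall>v\<in>{1..n}. path_operator l m n y v = x v"
proof -
  let ?q = "path_minor l m" and ?c = "\<lambda>k. path_functional l m k x"
  obtain z where z: "?c n = path_det l m n * z"
    using assms(4) by auto
  \<comment> \<open>Here \<open>w\<close> is the value that a row prescribes for \<open>l\<close>
    times the next unknown. Coprimality gives the quotient \<open>p\<close>; cancelling
    \<open>l\<close> then yields the relation needed to continue upwards.\<close>
  have step: "\<exists>p. l * p = w \<and> ?q k * p = ?c k + l * e" if "?q k * w = l * (?c k + l * e)" for k w e
  proof -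
    have "l dvd ?q k * w" using that by simp
    then have "l dvd w"
      using coprime_path_minor[OF assms(1), of k] by (simp add: coprime_commute coprime_dvd_mult_right_iff)
    then obtain p where "w = l * p" ..
    with that have "l * (?q k * p) = l * (?c k + l * e)" by (simp add: mult.left_commute)
    with \<open>w = l * p\<close> assms(2) show ?thesis by auto
  qed
  txt \<open>Row \<open>k + 1\<close> of the system determines \<open>y k\<close>, and \<open>step\<close> shows that it is an integer.
    At \<open>k = n\<close> the nonexistent entry \<open>y (n + 1)\<close> is read as \<open>y n\<close>, which turns the last row into
    an interior one.\<close>
  have "\<exists>y. (\<forall>v\<in>{n - d..n}. 1 < v \<longrightarrow> v \<noteq> n - d \<longrightarrow> path_operator l m n y v = x v) \<and>
      ?q (n - d) * y (n - d) = ?c (n - d) + l * ?q (n - d - 1) * y (if d = 0 then n else n - d + 1)"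
    if "d < n" for d
    using that
  proof (induction d)
    case 0
    \<comment> \<open>Only the entry at \<open>n\<close> enters here, and for the value
      \<open>z\<close> the claim is the defining equation of \<open>z\<close>.\<close>
    then show ?case
      using z by (intro exI[of _ "\<lambda>_. z"]) (auto simp: path_det_def algebra_simps)
  next
    case (Suc d)
    define j where "j = n - Suc d"
    have j: "n - d = Suc j" "1 \<le> j" "j < n" "d = 0 \<longleftrightarrow> Suc j = n" using Suc.prems by (auto simp: j_def)
    obtain y where y: "\<forall>v\<in>{Suc j..n}. 1 < v \<longrightarrow> v \<noteq> Suc j \<longrightarrow> path_operator l m n y v = x v"
      "?q (Suc j) * y (Suc j) = ?c (Suc j) + l * ?q j * y (if d = 0 then n else Suc j + 1)"
      using Suc j by auto
    obtain i where i: "j = Suc i" using j by (cases j) auto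
    \<comment> \<open>Row \<open>Suc j\<close> solved for \<open>l\<close> times the unknown entry
      at \<open>j\<close>.\<close>
    define w where "w = (m + 2 * l) * y (Suc j) - l * y (if d = 0 then n else Suc j + 1) - x (Suc j)"
    \<comment> \<open>The invariant at \<open>Suc j\<close>, with \<open>path_functional\<close> and
      \<open>path_minor\<close> unfolded once, has the shape that \<open>step\<close>
      requires.\<close>
    have "?q j * w = l * (?c j + l * (?q i * y (Suc j)))"
      using y(2) i by (simp add: w_def algebra_simps power2_eq_square)
    then obtain p where p: "l * p = w" "?q j * p = ?c j + l * (?q i * y (Suc j))"
      using step by blast
    define y' where "y' = y(j := p)"
    have "path_operator l m n y' (Suc j) = x (Suc j)"
      using p(1) j by (auto simp: path_operator_def y'_def w_def algebra_simps split: if_splits)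
    moreover have "path_operator l m n y' v = x v" if "v \<in> {Suc j..n}" "v \<noteq> Suc j" for v
    proof -
      have "path_operator l m n y' v = path_operator l m n y v"
        using that by (auto simp: path_operator_def y'_def)
      then show ?thesis using y(1) that j by auto
    qed
    moreover have "?q j * y' j = ?c j + l * ?q (j - 1) * y' (j + 1)"
      using p(2) i by (simp add: y'_def algebra_simps)
    ultimately show ?case
      unfolding j_def[symmetric]
      by (intro exI[of _ y']) (auto simp: le_Suc_eq, metis Suc_leI atLeastAtMost_iff le_neq_implies_less)
  qed
  from this[of "n - 1"] assms(3) obtain y where
    y: "\<forall>v\<in>{1..n}. 1 < v \<longrightarrow> path_operator l m n y v = x v" "?q 1 * y 1 = ?c 1 + l * ?q 0 * y 2"
    by (auto simp: numeral_2_eq_2)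
  \<comment> \<open>The invariant at index 1 is the first row itself.\<close>
  moreover have "path_operator l m n y 1 = x 1"
    using y(2) assms(3) by (simp add: path_operator_def algebra_simps numeral_2_eq_2)
  ultimately show ?thesis
    by (intro exI[of _ y]) (metis atLeastAtMost_iff le_neq_implies_less)
qed

section \<open>Evaluation of the polynomials \<open>f_poly\<close>\<close>

lemma eval_f_poly_rec:
  "eval_xy (f_poly (int (Suc (Suc k)))) a b
     = a * eval_xy (f_poly (int (Suc k))) a b - b\<^sup>2 * eval_xy (f_poly (int k)) a b"
  by (subst f_poly.simps) (simp add: eval_xy_def var_x_def var_y_def power2_eq_square)

lemma eval_f_poly_0: "eval_xy (f_poly 0) a b = 1"
  by (simp add: f_poly.simps eval_xy_def)

lemma eval_f_poly_1: "eval_xy (f_poly 1) a b = a"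
  by (simp add: f_poly.simps[of 1] f_poly.simps[of 0] f_poly.simps[of "-1"] eval_xy_def var_x_def)

text \<open>The recurrence preserves homogeneity, so the polynomial of index \<open>k\<close> is
  homogeneous of degree \<open>k\<close>. This is the source of the factor
  \<open>r ^ (n - 1)\<close>.\<close>

lemma eval_f_poly_scale:
  "eval_xy (f_poly (int k)) (r * a) (r * b) = r ^ k * eval_xy (f_poly (int k)) a b"
proof (induction k rule: induct_nat_012)
  case (ge2 k)
  then show ?case by (simp add: eval_f_poly_rec del: of_nat_Suc) (simp add: algebra_simps power2_eq_square)
qed (simp_all add: eval_f_poly_0 eval_f_poly_1)

text \<open>At these arguments \<open>f_poly\<close> gives the tridiagonal determinants with
  constant diagonal \<open>m + 2 * l\<close>. Lowering the first diagonal entry by \<open>l\<close>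
  subtracts \<open>l\<close> times the determinant of one size smaller.\<close>

lemma path_minor_eq_f_poly:
  "path_minor l m (Suc k) =
     eval_xy (f_poly (int (Suc k))) (m + 2 * l) (- l) - l * eval_xy (f_poly (int k)) (m + 2 * l) (- l)"
proof (induction k rule: induct_nat_012)
  case (ge2 k)
  show ?case
    unfolding path_minor.simps(3)[of l m "Suc k"] ge2 eval_f_poly_rec by (simp add: algebra_simps power2_eq_square)
qed (simp_all add: eval_f_poly_0 eval_f_poly_1 eval_f_poly_rec[of 0, simplified] algebra_simps power2_eq_square)

text \<open>With both corner entries lowered and n = k + 2, the determinant is f_n - 2 l f_(n-1) +
  l^2 f_(n-2), which the recurrence collapses to m f_(n-1).\<close>

lemma path_det_eq_f_poly:
  "path_det l m (Suc (Suc k)) = m * eval_xy (f_poly (int (Suc k))) (m + 2 * l) (- l)"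
  by (simp add: path_det_def path_minor_eq_f_poly eval_f_poly_rec del: of_nat_Suc path_minor.simps)
     (simp add: algebra_simps power2_eq_square)

section \<open>A unimodular coordinate system on Z^n\<close>

definition path_coordinate ::
  "int \<Rightarrow> int \<Rightarrow> (nat \<Rightarrow> int) \<Rightarrow> (nat \<Rightarrow> int) \<Rightarrow> nat \<Rightarrow> (nat \<Rightarrow> int) \<Rightarrow> int" where
  "path_coordinate l m s t k x = s k * path_functional l m k x - t k * x (Suc k)"

lemma path_coordinate_add:
  "path_coordinate l m s t k (\<lambda>i. x i + y i) = path_coordinate l m s t k x + path_coordinate l m s t k y"
  by (simp add: path_coordinate_def path_functional_add algebra_simps)

lemma path_coordinate_scale:
  "path_coordinate l m s t k (\<lambda>i. c * x i) = c * path_coordinate l m s t k x"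
  by (simp add: path_coordinate_def path_functional_scale algebra_simps)

lemma path_coordinate_cong:
  "(\<And>i. 1 \<le> i \<Longrightarrow> i \<le> Suc k \<Longrightarrow> x i = y i) \<Longrightarrow> path_coordinate l m s t k x = path_coordinate l m s t k y"
  unfolding path_coordinate_def by (auto intro!: arg_cong2[of _ _ _ _ "(-)"] path_functional_cong)

context
  fixes l m :: int and s t :: "nat \<Rightarrow> int"
  assumes bezout: "s k * path_minor l m k + t k * l = 1"
begin

text \<open>By the Bezout relation, passing from c_k and x_(k+1) to c_(k+1) and the k-th coordinate
  has determinant -1. This lemma and the next give the inverse transformation.\<close>

lemma path_functional_from_coordinates:
  "path_functional l m k x
     = t k * path_functional l m (Suc k) x + path_minor l m k * path_coordinate l m s t k x"
proof -
  have "t k * path_functional l m (Suc k) x + path_minor l m k * path_coordinate l m s t k x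
      = (s k * path_minor l m k + t k * l) * path_functional l m k x"
    by (simp add: path_coordinate_def algebra_simps)
  then show ?thesis by (simp add: bezout)
qed

lemma entry_from_coordinates:
  "x (Suc k) = s k * path_functional l m (Suc k) x - l * path_coordinate l m s t k x"
proof -
  have "s k * path_functional l m (Suc k) x - l * path_coordinate l m s t k x
      = (s k * path_minor l m k + t k * l) * x (Suc k)"
    by (simp add: path_coordinate_def algebra_simps)
  then show ?thesis by (simp add: bezout)
qed

text \<open>The inverse formulas recover the entries from the last one downwards with integer
  coefficients. Index 0 is left out because the functional of index 1 is already
  \<open>x 1\<close>.\<close>

lemma dvd_coordinates_imp_dvd:
  assumes "1 \<le> n" "r dvd path_functional l m n x" "\<forall>k\<in>{1..<n}. r dvd path_coordinate l m s t k x" "i \<in> {1..n}"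
  shows "r dvd x i"
  using assms
proof (induction n arbitrary: i rule: nat_induct_at_least)
  case base
  then show ?case by simp
next
  case (Suc n)
  have a: "r dvd path_coordinate l m s t n x" using Suc by simp
  show ?case
  proof (cases "i = Suc n")
    case True
    have "r dvd s n * path_functional l m (Suc n) x - l * path_coordinate l m s t n x"
      using a Suc.prems(1) by (intro dvd_diff dvd_mult)
    then show ?thesis unfolding True by (subst entry_from_coordinates)
  next
    case False
    moreover have "r dvd path_functional l m n x"
      unfolding path_functional_from_coordinates[of n x] using a Suc.prems(1) by (intro dvd_add dvd_mult)
    ultimately show ?thesis using Suc by simp
  qed
qed

lemma path_coordinates_surj:
  assumes "1 \<le> n"
  shows "\<exists>x. path_functional l m n x = c \<and> (\<forall>k\<in>{1..<n}. path_coordinate l m s t k x = a k)"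
  using assms
proof (induction n arbitrary: c rule: nat_induct_at_least)
  case base
  show ?case by (intro exI[of _ "\<lambda>_. c"]) simp
next
  case (Suc n)
  \<comment> \<open>The value at \<open>n\<close> is forced by
    \<open>path_functional_from_coordinates\<close>.\<close>
  obtain x where x: "path_functional l m n x = t n * c + path_minor l m n * a n"
    "\<forall>k\<in>{1..<n}. path_coordinate l m s t k x = a k"
    using Suc.IH by blast
  \<comment> \<open>The new entry is the one prescribed by
    \<open>entry_from_coordinates\<close>.\<close>
  define y where "y = x(Suc n := s n * c - l * a n)"
  have f: "path_functional l m n y = t n * c + path_minor l m n * a n"
    using x(1) path_functional_cong[of n x y l m] by (simp add: y_def)
  have "path_functional l m (Suc n) y = (s n * path_minor l m n + t n * l) * c"
    by (simp add: f) (simp add: y_def algebra_simps)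
  moreover have "path_coordinate l m s t n y = (s n * path_minor l m n + t n * l) * a n"
    by (simp add: path_coordinate_def f) (simp add: y_def algebra_simps)
  moreover have "path_coordinate l m s t k y = a k" if "k \<in> {1..<n}" for k
    using that x(2) path_coordinate_cong[of k x y l m s t] by (simp add: y_def)
  ultimately show ?case
    by (intro exI[of _ y]) (auto simp: bezout less_Suc_eq simp del: path_functional.simps)
qed

text \<open>Membership in the image means that \<open>r\<close> divides every entry and that the
  quotient meets the one condition on \<open>path_det\<close>. Divisibility of the entries is read
  off the coordinates.\<close>

lemma path_operator_image_iff:
  assumes "coprime l m" "l \<noteq> 0" "n \<ge> 2" "r \<noteq> 0"
  shows "(\<exists>y. \<forall>v\<in>{1..n}. path_operator (r * l) (r * m) n y v = x v) \<longleftrightarrow>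
    r * path_det l m n dvd path_functional l m n x \<and> (\<forall>k\<in>{1..<n}. r dvd path_coordinate l m s t k x)"
    (is "?L \<longleftrightarrow> ?R")
proof
  assume ?L
  then obtain y where "\<forall>v\<in>{1..n}. r * path_operator l m n y v = x v"
    unfolding path_operator_scale by blast
  then have y: "x v = r * path_operator l m n y v" if "v \<in> {1..n}" for v
    using that by simp
  have "path_functional l m n x = r * (path_det l m n * y n)"
    using path_functional_cong[of n x "\<lambda>v. r * path_operator l m n y v"] y assms(3)
    by (simp add: path_functional_scale path_functional_path_operator)
  moreover have "path_coordinate l m s t k x = r * path_coordinate l m s t k (path_operator l m n y)"
    if "k \<in> {1..<n}" for k
    using path_coordinate_cong[of k x "\<lambda>v. r * path_operator l m n y v"] y that
    by (simp add: path_coordinate_scale)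
  ultimately show ?R by simp
next
  assume R: ?R
  then have "r dvd x i" if "i \<in> {1..n}" for i
    using dvd_coordinates_imp_dvd[of n r x i] that assms(3) dvd_mult_left by auto
  then have x: "x i = r * (x i div r)" if "i \<in> {1..n}" for i
    using that by simp
  have "path_functional l m n x = r * path_functional l m n (\<lambda>i. x i div r)"
    unfolding path_functional_scale[symmetric] by (rule path_functional_cong, rule x) simp
  then have "path_det l m n dvd path_functional l m n (\<lambda>i. x i div r)"
    using R assms(4) by simp
  from dvd_path_functional_imp_path_operator[OF assms(1-3) this]
  obtain y where y: "\<forall>v\<in>{1..n}. path_operator l m n y v = x v div r" by blast
  show ?L
  proof (intro exI[of _ y] ballI)
    fix v assume v: "v \<in> {1..n}"
    with y have "r * path_operator l m n y v = r * (x v div r)" by simp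
    with x[OF v] show "path_operator (r * l) (r * m) n y v = x v"
      by (simp only: path_operator_scale)
  qed
qed

end

section \<open>The reduced Laplacian of the cone over a duplicated path\<close>

lemma group_vertex_lattice: "group (vertex_lattice W)"
  by (simp add: vertex_lattice_def)

lemma adjacency_cone:
  assumes "finite (mverts H)"
  shows "adjacency (cone k H) (Some u) (Some v) = adjacency H u v"
proof -
  have "count (image_mset (image Some) M) (Some ` A) = count M A" for M :: "'a set multiset" and A
    by (induction M) (auto simp: inj_image_eq_iff)
  from this[of "medges H" "{u, v}"]
  have "count (image_mset (image Some) (medges H)) {Some u, Some v} = count (medges H) {u, v}"
    by simp
  \<comment> \<open>Every cone edge contains the sink, so none joins two old vertices.\<close>
  moreover have "count (\<Sum>v\<in>mverts H. replicate_mset k {None, Some v}) {Some u, Some v} = 0"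
    using assms by (auto simp: count_sum doubleton_eq_iff)
  ultimately show ?thesis
    by (simp add: adjacency_def cone_def)
qed

lemma vertex_degree_cone:
  assumes "finite (mverts H)" "v \<in> mverts H"
  shows "vertex_degree (cone k H) (Some v) = vertex_degree H v + k"
proof -
  have "size {#e \<in># (\<Sum>u\<in>W. replicate_mset k {None, Some u}). Some v \<in> e#} = (if v \<in> W then k else 0)"
    if "finite W" for W
    using that
  proof (induction W rule: finite_induct)
    case (insert u W)
    have "{#e \<in># replicate_mset k {None, Some u}. Some v \<in> e#} = (if v = u then replicate_mset k {None, Some u} else {#})"
      by (induction k) auto
    with insert show ?case by auto
  qed simp
  moreover have "size {#e \<in># image_mset (image Some) (medges H). Some v \<in> e#} = vertex_degree H v"
    by (simp add: filter_mset_image_mset vertex_degree_def inj_image_mem_iff)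
  ultimately show ?thesis
    using assms by (simp add: vertex_degree_def cone_def)
qed

lemma laplacian_cone:
  assumes "finite (mverts H)" "u \<in> mverts H"
  shows "laplacian (cone k H) (Some u) (Some v) = laplacian H u v + (if u = v then int k else 0)"
  using assms by (auto simp: laplacian_def adjacency_cone vertex_degree_cone)

lemma vertex_degree_duplication:
  assumes "finite (sedges G)"
  shows "vertex_degree (duplication G l) v = l * card {e \<in> sedges G. v \<in> e}"
proof -
  have "{#e \<in># repeat_mset l M. v \<in> e#} = repeat_mset l {#e \<in># M. v \<in> e#}" for M
    by (induction l) auto
  then show ?thesis
    using assms by (simp add: vertex_degree_def duplication_def)
qed

lemma adjacency_duplication:
  assumes "finite (sedges G)"
  shows "adjacency (duplication G l) u v = (if {u, v} \<in> sedges G then int l else 0)"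
  using assms by (simp add: adjacency_def duplication_def)

lemma finite_sedges_path_graph: "finite (sedges (path_graph n))"
proof -
  have "sedges (path_graph n) = (\<lambda>i. {i, i + 1}) ` {1..<n}"
    by (auto simp: path_graph_def)
  then show ?thesis by simp
qed

text \<open>Sorted by the position of \<open>u\<close> relative to \<open>v\<close>, so that a sum
  over \<open>u\<close> collapses to at most three terms. The guard \<open>1 < v\<close> keeps the
  non-vertex 0 out.\<close>

lemma laplacian_path:
  assumes "v \<in> {1..n}"
  shows "laplacian (duplication (path_graph n) l) u v =
    (if u = v then int l * ((if 1 < v then 1 else 0) + (if v < n then 1 else 0)) else 0)
      - (if 1 < v \<and> u = v - 1 then int l else 0) - (if v < n \<and> u = v + 1 then int l else 0)"
proof -
  have "{e \<in> sedges (path_graph n). v \<in> e} = (\<lambda>i. {i, i + 1}) ` {i \<in> {1..<n}. v = i \<or> v = i + 1}"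
    by (auto simp: path_graph_def)
  also have "{i \<in> {1..<n}. v = i \<or> v = i + 1} = (if 1 < v then {v - 1} else {}) \<union> (if v < n then {v} else {})"
    using assms by auto
  finally have "{e \<in> sedges (path_graph n). v \<in> e}
      = (if 1 < v then {{v - 1, v}} else {}) \<union> (if v < n then {{v, v + 1}} else {})"
    by auto
  \<comment> \<open>At an interior vertex the two edges must be distinct for the count to be
    2.\<close>
  moreover have "{v - 1, v} \<noteq> {v, v + 1}" by (auto simp: doubleton_eq_iff)
  ultimately have degree: "card {e \<in> sedges (path_graph n). v \<in> e}
      = (if 1 < v then 1 else 0) + (if v < n then 1 else 0)"
    by (simp split: if_split)
  have "{u, v} \<in> sedges (path_graph n) \<longleftrightarrow> (\<exists>i. {u, v} = {i, i + 1} \<and> 1 \<le> i \<and> i < n)"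
    by (simp add: path_graph_def)
  also have "\<dots> \<longleftrightarrow> 1 < v \<and> u = v - 1 \<or> v < n \<and> u = v + 1"
  proof
    assume "\<exists>i. {u, v} = {i, i + 1} \<and> 1 \<le> i \<and> i < n"
    then show "1 < v \<and> u = v - 1 \<or> v < n \<and> u = v + 1"
      by (auto simp: doubleton_eq_iff)
  next
    assume "1 < v \<and> u = v - 1 \<or> v < n \<and> u = v + 1"
    then show "\<exists>i. {u, v} = {i, i + 1} \<and> 1 \<le> i \<and> i < n"
    proof
      assume "1 < v \<and> u = v - 1"
      with assms show ?thesis by (intro exI[of _ u]) auto
    next
      assume "v < n \<and> u = v + 1"
      with assms show ?thesis by (intro exI[of _ v]) auto
    qed
  qed
  finally have edge: "{u, v} \<in> sedges (path_graph n) \<longleftrightarrow> 1 < v \<and> u = v - 1 \<or> v < n \<and> u = v + 1" .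
  show ?thesis
    unfolding laplacian_def vertex_degree_duplication[OF finite_sedges_path_graph]
      adjacency_duplication[OF finite_sedges_path_graph] degree edge
    by (cases "u = v"; cases "u = v + 1"; cases "1 < v \<and> u = v - 1") auto
qed

lemma mverts_cone_path: "mverts (cone k (duplication (path_graph n) l)) - {None} = Some ` {1..n}"
  by (auto simp: cone_def duplication_def path_graph_def)

lemma sum_laplacian_cone_path:
  assumes v: "v \<in> {1..n}"
  shows "(\<Sum>u\<in>Some ` {1..n}. laplacian (cone k (duplication (path_graph n) l)) u (Some v) * x u)
    = path_operator (int l) (int k) n (x \<circ> Some) v"
proof -
  have "(\<Sum>u\<in>Some ` {1..n}. laplacian (cone k (duplication (path_graph n) l)) u (Some v) * x u)
    = (\<Sum>u=1..n. (laplacian (duplication (path_graph n) l) u v + (if u = v then int k else 0)) * x (Some u))"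
    by (subst sum.reindex) (auto simp: laplacian_cone duplication_def path_graph_def intro!: sum.cong)
  also have "\<dots> = (\<Sum>u=1..n. (if u = v then (int k + int l * ((if 1 < v then 1 else 0) + (if v < n then 1 else 0))) * x (Some u) else 0)
      - (if u = v - 1 then if 1 < v then int l * x (Some u) else 0 else 0)
      - (if u = v + 1 then if v < n then int l * x (Some u) else 0 else 0))"
    unfolding laplacian_path[OF v] by (intro sum.cong) (auto simp: algebra_simps)
  also have "\<dots> = path_operator (int l) (int k) n (x \<circ> Some) v"
  proof -
    \<comment> \<open>\<open>sum.delta\<close> leaves the test whether \<open>v - 1\<close> lies in
      \<open>{1..n}\<close>, which fails only at the first vertex.\<close>
    have "v = Suc 0" if "\<not> Suc 0 \<le> v - Suc 0" using that v unfolding atLeastAtMost_iff by linarith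
    then show ?thesis
      unfolding sum_subtractf sum.delta[OF finite_atLeastAtMost]
      using v by (auto simp: path_operator_def algebra_simps)
  qed
  finally show ?thesis .
qed

lemma reduced_laplacian_image_cone_path:
  "reduced_laplacian_image (cone k (duplication (path_graph n) l)) None =
     {x \<in> carrier (vertex_lattice (Some ` {1..n})).
        \<exists>y. \<forall>v\<in>{1..n}. path_operator (int l) (int k) n y v = x (Some v)}"
    (is "?I = {x \<in> carrier ?G. ?R x}")
proof (intro subset_antisym subsetI)
  fix x assume "x \<in> ?I"
  then obtain y where
    x: "x = (\<lambda>v\<in>Some ` {1..n}. \<Sum>u\<in>Some ` {1..n}. laplacian (cone k (duplication (path_graph n) l)) u v * y u)"
    unfolding reduced_laplacian_image_def mverts_cone_path by blast
  have "path_operator (int l) (int k) n (y \<circ> Some) v = x (Some v)" if "v \<in> {1..n}" for v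
    unfolding x using that by (simp only: sum_laplacian_cone_path restrict_apply' imageI)
  moreover have "x \<in> carrier ?G"
    unfolding x vertex_lattice_def by simp
  ultimately show "x \<in> {x \<in> carrier ?G. ?R x}" by blast
next
  fix x assume "x \<in> {x \<in> carrier ?G. ?R x}"
  then obtain y where x: "x \<in> carrier ?G"
    and y: "\<And>v. v \<in> {1..n} \<Longrightarrow> path_operator (int l) (int k) n y v = x (Some v)" by blast
  \<comment> \<open>\<open>path_operator\<close> reads only entries in \<open>{1..n}\<close> at
    these rows, so any solution can be cut down to an element of the lattice.\<close>
  define z where "z = (\<lambda>v\<in>Some ` {1..n}. y (the v))"
  have z: "path_operator (int l) (int k) n (z \<circ> Some) v = x (Some v)" if "v \<in> {1..n}" for v
    unfolding y[OF that, symmetric] using that by (intro path_operator_cong) (auto simp: z_def)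
  have "x = (\<lambda>v\<in>Some ` {1..n}. \<Sum>u\<in>Some ` {1..n}. laplacian (cone k (duplication (path_graph n) l)) u v * z u)"
  proof (rule extensionalityI)
    show "x \<in> extensional (Some ` {1..n})"
      using x by (simp add: vertex_lattice_def PiE_def)
    fix v assume v: "v \<in> Some ` {1..n}"
    then obtain w where "v = Some w" "w \<in> {1..n}" by blast
    with v z show "x v = (\<lambda>v\<in>Some ` {1..n}. \<Sum>u\<in>Some ` {1..n}.
        laplacian (cone k (duplication (path_graph n) l)) u v * z u) v"
      by (simp only: sum_laplacian_cone_path restrict_apply')
  qed (rule restrict_extensional)
  moreover have "z \<in> carrier ?G" by (simp add: vertex_lattice_def z_def)
  ultimately show "x \<in> ?I"
    unfolding reduced_laplacian_image_def mverts_cone_path by blast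
qed

section \<open>The isomorphism with the product of cyclic groups\<close>

lemma mod_nat_abs_eq_0_iff:
  "x mod int (nat \<bar>d\<bar>) = 0 \<longleftrightarrow> d dvd x"
  by (simp add: dvd_eq_mod_eq_0[symmetric])

text \<open>This includes \<open>d = 0\<close>, which occurs for \<open>m = 0\<close>: reduction is
  then the identity and the carrier consists of all integers.\<close>

lemma mod_in_carrier_integer_mod_group: "x mod int d \<in> carrier (integer_mod_group d)"
  by (simp add: carrier_integer_mod_group)

lemma mod_carrier_integer_mod_group: "x \<in> carrier (integer_mod_group d) \<Longrightarrow> x mod int d = x"
  by (auto simp: carrier_integer_mod_group split: if_splits)

lemma restrict_eq_iff: "restrict f A = restrict g A \<longleftrightarrow> (\<forall>x\<in>A. f x = g x)"
  by (auto simp: restrict_def fun_eq_iff)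

lemma critical_group_path_cone:
  assumes "coprime a b" "a \<ge> 1" "r \<ge> 1" "n \<ge> 2"
  shows "critical_group (cone (r * b) (duplication (path_graph n) (r * a))) None \<cong>
      product_group {1..n - 1} (\<lambda>_. integer_mod_group r) \<times>\<times>
      integer_mod_group (nat \<bar>int r * path_det (int a) (int b) n\<bar>)"
    (is "critical_group ?C None \<cong> ?P \<times>\<times> integer_mod_group ?D")
proof -
  let ?l = "int a" and ?m = "int b" and ?G = "vertex_lattice (Some ` {1..n})"
  have cop: "coprime ?l ?m" using assms by simp
  have "\<exists>s t. s * path_minor ?l ?m k + t * ?l = 1" for k
    using bezout_int[of "path_minor ?l ?m k" ?l] coprime_path_minor[OF cop, of k]
    by (auto simp: coprime_iff_gcd_eq_1)
  then obtain s t where st: "\<And>k. s k * path_minor ?l ?m k + t k * ?l = 1" by metis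
  let ?\<alpha> = "path_coordinate ?l ?m s t" and ?c = "path_functional ?l ?m n"
  define f where "f x = (\<lambda>k\<in>{1..n - 1}. ?\<alpha> k (x \<circ> Some) mod int r)" for x :: "nat option \<Rightarrow> int"
  define g where "g x = ?c (x \<circ> Some) mod int ?D" for x :: "nat option \<Rightarrow> int"
  \<comment> \<open>Multiplication in the product group is pointwise only on its index set; the
    functionals read no other entries.\<close>
  have mult: "(x \<otimes>\<^bsub>?G\<^esub> y) (Some i) = x (Some i) + y (Some i)" if "i \<in> {1..n}" for x y i
    using that by (simp add: vertex_lattice_def)
  have \<alpha>_mult: "?\<alpha> k ((x \<otimes>\<^bsub>?G\<^esub> y) \<circ> Some) = ?\<alpha> k (x \<circ> Some) + ?\<alpha> k (y \<circ> Some)"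
    if "k \<in> {1..n - 1}" for k x y
    unfolding path_coordinate_add[symmetric]
  proof (rule path_coordinate_cong)
    fix i assume "1 \<le> i" "i \<le> Suc k"
    with that have "i \<in> {1..n}" by auto
    then show "((x \<otimes>\<^bsub>?G\<^esub> y) \<circ> Some) i = (x \<circ> Some) i + (y \<circ> Some) i"
      by (simp only: comp_apply mult)
  qed
  have c_mult: "?c ((x \<otimes>\<^bsub>?G\<^esub> y) \<circ> Some) = ?c (x \<circ> Some) + ?c (y \<circ> Some)" for x y
    unfolding path_functional_add[symmetric] by (rule path_functional_cong) (simp only: comp_apply mult atLeastAtMost_iff)
  have "f \<in> hom ?G ?P"
  proof (rule homI)
    show "f x \<in> carrier ?P" for x
      by (auto simp: f_def mod_in_carrier_integer_mod_group)
    show "f (x \<otimes>\<^bsub>?G\<^esub> y) = f x \<otimes>\<^bsub>?P\<^esub> f y" for x y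
      unfolding f_def mult_product_group
      by (intro restrict_ext) (simp only: \<alpha>_mult restrict_apply' mult_integer_mod_group mod_add_eq)
  qed
  moreover have "g \<in> hom ?G (integer_mod_group ?D)"
    by (rule homI)
      (simp_all only: g_def c_mult mult_integer_mod_group mod_in_carrier_integer_mod_group mod_add_eq)
  ultimately interpret group_hom ?G "?P \<times>\<times> integer_mod_group ?D" "\<lambda>x. (f x, g x)"
    by (intro group_hom.intro group_hom_axioms.intro DirProd_group product_group group_integer_mod_group
        group_vertex_lattice) (simp add: hom_paired)
  have "(u, w) \<in> (\<lambda>x. (f x, g x)) ` carrier ?G"
    if u: "u \<in> carrier ?P" and w: "w \<in> carrier (integer_mod_group ?D)" for u w
  proof -
    \<comment> \<open>Residues are integers here, so \<open>w\<close> and \<open>u\<close> can be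
      prescribed as coordinate values; lying in the carriers, they are fixed by reduction.\<close>
    obtain x where x: "?c x = w" "\<forall>k\<in>{1..<n}. ?\<alpha> k x = u k"
      using path_coordinates_surj[OF st, of n w u] assms(4) by auto
    define y where "y = (\<lambda>v\<in>Some ` {1..n}. x (the v))"
    have "?c (y \<circ> Some) = w"
      using x(1) path_functional_cong[of n "y \<circ> Some" x] by (simp add: y_def)
    then have "g y = w"
      unfolding g_def using mod_carrier_integer_mod_group[OF w] by (simp only:)
    moreover have "f y = u"
    proof
      fix k
      show "f y k = u k"
      proof (cases "k \<in> {1..n - 1}")
        case True
        then have "?\<alpha> k (y \<circ> Some) = ?\<alpha> k x"
          by (intro path_coordinate_cong) (auto simp: y_def)
        moreover have "?\<alpha> k x = u k" using x(2) True by auto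
        moreover have "u k mod int r = u k"
          using u True by (intro mod_carrier_integer_mod_group) auto
        ultimately show ?thesis using True by (simp add: f_def)
      next
        case False
        then show ?thesis using u by (auto simp: f_def PiE_def extensional_def)
      qed
    qed
    moreover have "y \<in> carrier ?G" by (auto simp: vertex_lattice_def y_def)
    ultimately show ?thesis by blast
  qed
  moreover have "(\<lambda>x. (f x, g x)) ` carrier ?G \<subseteq> carrier (?P \<times>\<times> integer_mod_group ?D)"
    using hom_closed by blast
  ultimately have "(\<lambda>x. (f x, g x)) ` carrier ?G = carrier (?P \<times>\<times> integer_mod_group ?D)"
    by auto
  then have "?G Mod kernel ?G (?P \<times>\<times> integer_mod_group ?D) (\<lambda>x. (f x, g x)) \<cong> ?P \<times>\<times> integer_mod_group ?D"
    by (rule FactGroup_iso)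
  moreover have "kernel ?G (?P \<times>\<times> integer_mod_group ?D) (\<lambda>x. (f x, g x)) = reduced_laplacian_image ?C None"
  proof -
    \<comment> \<open>The vanishing of all residues is the divisibility criterion of
      \<open>path_operator_image_iff\<close>.\<close>
    have "(f x, g x) = \<one>\<^bsub>?P \<times>\<times> integer_mod_group ?D\<^esub> \<longleftrightarrow>
        (\<exists>y. \<forall>v\<in>{1..n}. path_operator (int (r * a)) (int (r * b)) n y v = x (Some v))" for x
    proof -
      have "f x = \<one>\<^bsub>?P\<^esub> \<longleftrightarrow> (\<forall>k\<in>{1..<n}. int r dvd ?\<alpha> k (x \<circ> Some))"
      proof -
        have "f x = \<one>\<^bsub>?P\<^esub> \<longleftrightarrow> (\<forall>k\<in>{1..n - 1}. ?\<alpha> k (x \<circ> Some) mod int r = 0)"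
          unfolding f_def one_product_group one_integer_mod_group by (rule restrict_eq_iff)
        moreover have "{1..n - 1} = {1..<n}" using assms(4) by auto
        ultimately show ?thesis by (simp only: dvd_eq_mod_eq_0)
      qed
      moreover have "g x = 0 \<longleftrightarrow> int r * path_det ?l ?m n dvd ?c (x \<circ> Some)"
        unfolding g_def by (rule mod_nat_abs_eq_0_iff)
      moreover have "(\<exists>y. \<forall>v\<in>{1..n}. path_operator (int (r * a)) (int (r * b)) n y v = (x \<circ> Some) v) \<longleftrightarrow>
          int r * path_det ?l ?m n dvd ?c (x \<circ> Some) \<and> (\<forall>k\<in>{1..<n}. int r dvd ?\<alpha> k (x \<circ> Some))"
        unfolding of_nat_mult
        by (rule path_operator_image_iff[OF st cop]) (use assms in simp_all)
      ultimately show ?thesis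
        unfolding one_DirProd prod.inject one_integer_mod_group comp_apply by (simp only: conj_commute)
    qed
    then show ?thesis
      unfolding reduced_laplacian_image_cone_path kernel_def by blast
  qed
  ultimately show ?thesis
    by (simp add: critical_group_def mverts_cone_path)
qed

theorem corollary3p1:
  fixes m l n r :: nat
  assumes "l \<ge> 1" and "n \<ge> 2" and "r = gcd l m"
  shows "int r ^ (n - 1) dvd int m * eval_xy (f_poly (int n - 1)) (int m + 2 * int l) (- int l) \<and>
    critical_group (cone m (duplication (path_graph n) l)) None \<cong>
      product_group {1..n - 1} (\<lambda>_. integer_mod_group r) \<times>\<times>
      integer_mod_group (nat \<bar>(int m * eval_xy (f_poly (int n - 1)) (int m + 2 * int l) (- int l))
                              div int r ^ (n - 1)\<bar>)"
proof -
  have r: "r \<ge> 1" using assms by (simp add: Suc_le_eq)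
  obtain a b where ab: "l = r * a" "m = r * b" "coprime a b"
  proof -
    have "gcd l m \<noteq> 0" using assms(1) by simp
    from gcd_coprime_exists[OF this] that show ?thesis
      unfolding assms(3) by (metis mult.commute)
  qed
  then have "a \<ge> 1" using assms(1) by (cases a) auto
  obtain k where k: "n = Suc (Suc k)" using assms(2) by (metis add_2_eq_Suc le_Suc_ex)
  then have n: "int n - 1 = int (Suc k)" by simp
  have scale: "int m + 2 * int l = int r * (int b + 2 * int a)" "- int l = int r * - int a"
    by (simp_all add: ab algebra_simps)
  have "eval_xy (f_poly (int (Suc k))) (int m + 2 * int l) (- int l)
      = int r ^ Suc k * eval_xy (f_poly (int (Suc k))) (int b + 2 * int a) (- int a)"
    unfolding scale by (rule eval_f_poly_scale)
  \<comment> \<open>Homogeneity supplies \<open>r ^ (n - 1)\<close>; the further factor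
    \<open>r\<close> comes from \<open>m = r * b\<close> and stays in the modulus of the last cyclic
    group.\<close>
  then have "int m * eval_xy (f_poly (int n - 1)) (int m + 2 * int l) (- int l)
      = int r ^ (n - 1) * (int r * path_det (int a) (int b) n)"
    unfolding n unfolding path_det_eq_f_poly k by (simp add: ab(2) del: of_nat_Suc power_Suc)
  moreover have "int r ^ (n - 1) \<noteq> 0" using r by simp
  moreover have "critical_group (cone m (duplication (path_graph n) l)) None \<cong>
      product_group {1..n - 1} (\<lambda>_. integer_mod_group r) \<times>\<times>
      integer_mod_group (nat \<bar>int r * path_det (int a) (int b) n\<bar>)"
    using critical_group_path_cone[OF ab(3) \<open>a \<ge> 1\<close> r assms(2)] by (simp only: ab)
  ultimately show ?thesis by (simp only: dvd_triv_left nonzero_mult_div_cancel_left simp_thms)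
qed

end
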